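(* Let $\sigma_{(\cdot,\triangleleft)}$ denote the birack on a set $X$ associated to a pair of operations $\cdot$ and $\triangleleft$, and let $\phi:X\to X$ be a linear automorphism of it. Put $$x\cdot_\phi y:=x\cdot\phi(y)=\phi(x\cdot y),\qquad x\triangleleft_\phi y:=\phi(x)\triangleleft y,\qquad x\triangleleft_{\phi^{-1}}y:=\phi^{-1}(x)\triangleleft y.$$ Then the twisted solutions can be described by $${}^\phi\big(\sigma_{(\cdot,\triangleleft)}\big)=\sigma_{(\cdot,\triangleleft)}(\phi\times\mathrm{Id})=\sigma_{(\cdot,\triangleleft_\phi)},$$ $$\big(\sigma_{(\cdot,\triangleleft)}\big)^{\phi^{-1}}=\sigma_{(\cdot,\triangleleft)}(\mathrm{Id}\times\phi^{-1})=\sigma_{(\cdot_\phi,\triangleleft_{\phi^{-1}})}.$$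
   Context: A birack on $X$ is a bijective map $\sigma:X\times X\to X\times X$, $\sigma(x,y)=(g_x(y),f_y(x))$, satisfying the braid equation $(\sigma\times \mathrm{Id})(\mathrm{Id}\times\sigma)(\sigma\times \mathrm{Id})=(\mathrm{Id}\times\sigma)(\sigma\times \mathrm{Id})(\mathrm{Id}\times\sigma)$, such that all $g_x$ and all $f_y$ are bijections of $X$. Its associated operations are: $x*y:=g_x(y)$; $x\cdot(-)$, the inverse of the bijection $x*(-)$; and $x\triangleleft y:=g_y(f_{g_x^{-1}(y)}(x))$. For any binary operations $\cdot,\triangleleft$ on $X$ with every $x\cdot(-)$ bijective, with inverse denoted $x*(-)$, the map $\sigma_{(\cdot,\triangleleft)}$ is defined by $\sigma_{(\cdot,\triangleleft)}(x,y):=\big(x*y,\ (x*y)\cdot(x\triangleleft(x*y))\big)$. A birack equals $\sigma_{(\cdot,\triangleleft)}$ for its associated operations. A linear automorphism is a bijection $\phi:X\to X$ such that for all $x,y\in X$: $\phi(x\cdot y)=x\cdot\phi(y)$, $\phi(x)\cdot y=x\cdot y$, $\phi(x\triangleleft y)=\phi(x)\triangleleft y$, $x\triangleleft\phi(y)=x\triangleleft y$. The inverse of a linear automorphism is again one. Notation: ${}^\phi\sigma:=\sigma(\phi\times\mathrm{Id})$ and $\sigma^\phi:=\sigma(\mathrm{Id}\times\phi)$. *)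

theory Defs
  imports Main
begin

text \<open>
  The set \<open>X\<close> is the universe of the type \<open>'a\<close>. A map
  \<open>\<sigma>(x,y) = (g\<^sub>x(y), f\<^sub>y(x))\<close> has components \<open>g_of \<sigma> x y\<close> and
  \<open>f_of \<sigma> y x\<close>; in both, the first argument is the index.
\<close>

definition g_of :: "('a \<times> 'a \<Rightarrow> 'a \<times> 'a) \<Rightarrow> 'a \<Rightarrow> 'a \<Rightarrow> 'a" where
  "g_of \<sigma> x y = fst (\<sigma> (x, y))"

definition f_of :: "('a \<times> 'a \<Rightarrow> 'a \<times> 'a) \<Rightarrow> 'a \<Rightarrow> 'a \<Rightarrow> 'a" where
  "f_of \<sigma> y x = snd (\<sigma> (x, y))"

text \<open>
  Triples are nested to the right, so \<open>Id \<times> \<sigma>\<close> is a plain \<open>map_prod\<close>, whereas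
  \<open>\<sigma> \<times> Id\<close> has to rebracket.
\<close>

definition act_left :: "('a \<times> 'a \<Rightarrow> 'a \<times> 'a) \<Rightarrow> 'a \<times> 'a \<times> 'a \<Rightarrow> 'a \<times> 'a \<times> 'a" where
  "act_left \<sigma> = (\<lambda>(x, y, z). case \<sigma> (x, y) of (u, v) \<Rightarrow> (u, v, z))"

definition act_right :: "('a \<times> 'a \<Rightarrow> 'a \<times> 'a) \<Rightarrow> 'a \<times> 'a \<times> 'a \<Rightarrow> 'a \<times> 'a \<times> 'a" where
  "act_right \<sigma> = map_prod id \<sigma>"

definition braid_equation :: "('a \<times> 'a \<Rightarrow> 'a \<times> 'a) \<Rightarrow> bool" where
  "braid_equation \<sigma> \<longleftrightarrow>
     act_left \<sigma> \<circ> act_right \<sigma> \<circ> act_left \<sigma> = act_right \<sigma> \<circ> act_left \<sigma> \<circ> act_right \<sigma>"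

definition birack :: "('a \<times> 'a \<Rightarrow> 'a \<times> 'a) \<Rightarrow> bool" where
  "birack \<sigma> \<longleftrightarrow>
     bij \<sigma> \<and> braid_equation \<sigma> \<and> (\<forall>x. bij (g_of \<sigma> x)) \<and> (\<forall>y. bij (f_of \<sigma> y))"

definition assoc_dot :: "('a \<times> 'a \<Rightarrow> 'a \<times> 'a) \<Rightarrow> 'a \<Rightarrow> 'a \<Rightarrow> 'a" where
  "assoc_dot \<sigma> x = inv (g_of \<sigma> x)"

definition assoc_tri :: "('a \<times> 'a \<Rightarrow> 'a \<times> 'a) \<Rightarrow> 'a \<Rightarrow> 'a \<Rightarrow> 'a" where
  "assoc_tri \<sigma> x y = g_of \<sigma> y (f_of \<sigma> (inv (g_of \<sigma> x) y) x)"

text \<open>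
  \<open>star_of dot x\<close> is the inverse of \<open>dot x\<close>; it and \<open>sigma_of dot tri\<close> are
  meaningful only if every \<open>dot x\<close> is a bijection.
\<close>

definition star_of :: "('a \<Rightarrow> 'a \<Rightarrow> 'a) \<Rightarrow> 'a \<Rightarrow> 'a \<Rightarrow> 'a" where
  "star_of dot x = inv (dot x)"

definition sigma_of :: "('a \<Rightarrow> 'a \<Rightarrow> 'a) \<Rightarrow> ('a \<Rightarrow> 'a \<Rightarrow> 'a) \<Rightarrow> 'a \<times> 'a \<Rightarrow> 'a \<times> 'a" where
  "sigma_of dot tri =
     (\<lambda>(x, y). (star_of dot x y, dot (star_of dot x y) (tri x (star_of dot x y))))"

definition linear_automorphism :: "('a \<times> 'a \<Rightarrow> 'a \<times> 'a) \<Rightarrow> ('a \<Rightarrow> 'a) \<Rightarrow> bool" where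
  "linear_automorphism \<sigma> \<phi> \<longleftrightarrow>
     bij \<phi> \<and>
     (\<forall>x y. \<phi> (assoc_dot \<sigma> x y) = assoc_dot \<sigma> x (\<phi> y)) \<and>
     (\<forall>x y. assoc_dot \<sigma> (\<phi> x) y = assoc_dot \<sigma> x y) \<and>
     (\<forall>x y. \<phi> (assoc_tri \<sigma> x y) = assoc_tri \<sigma> (\<phi> x) y) \<and>
     (\<forall>x y. assoc_tri \<sigma> x (\<phi> y) = assoc_tri \<sigma> x y)"

definition twist_left :: "('a \<Rightarrow> 'a) \<Rightarrow> ('a \<times> 'a \<Rightarrow> 'a \<times> 'a) \<Rightarrow> 'a \<times> 'a \<Rightarrow> 'a \<times> 'a" where
  "twist_left \<phi> \<sigma> = \<sigma> \<circ> map_prod \<phi> id"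

definition twist_right :: "('a \<times> 'a \<Rightarrow> 'a \<times> 'a) \<Rightarrow> ('a \<Rightarrow> 'a) \<Rightarrow> 'a \<times> 'a \<Rightarrow> 'a \<times> 'a" where
  "twist_right \<sigma> \<phi> = \<sigma> \<circ> map_prod id \<phi>"

definition dot_twist :: "('a \<Rightarrow> 'a \<Rightarrow> 'a) \<Rightarrow> ('a \<Rightarrow> 'a) \<Rightarrow> 'a \<Rightarrow> 'a \<Rightarrow> 'a" where
  "dot_twist dot \<phi> x y = dot x (\<phi> y)"

definition tri_twist :: "('a \<Rightarrow> 'a \<Rightarrow> 'a) \<Rightarrow> ('a \<Rightarrow> 'a) \<Rightarrow> 'a \<Rightarrow> 'a \<Rightarrow> 'a" where
  "tri_twist tri \<phi> x y = tri (\<phi> x) y"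

text \<open>
  Passing between operations and maps is mutually inverse, so a linear automorphism of
  \<open>sigma_of dot tri\<close> satisfies the defining identities for \<open>dot\<close> and \<open>tri\<close> themselves.
\<close>

lemma assoc_dot_sigma_of:
  assumes "\<And>x. bij (dot x)"
  shows "assoc_dot (sigma_of dot tri) = dot"
proof
  fix x
  have "g_of (sigma_of dot tri) x = inv (dot x)"
    by (simp add: fun_eq_iff g_of_def sigma_of_def star_of_def)
  then show "assoc_dot (sigma_of dot tri) x = dot x"
    by (simp add: assoc_dot_def inv_inv_eq assms)
qed

lemma assoc_tri_sigma_of:
  assumes "\<And>x. bij (dot x)"
  shows "assoc_tri (sigma_of dot tri) = tri"
proof (intro ext)
  fix x y
  have g: "g_of (sigma_of dot tri) z = inv (dot z)" for z
    by (simp add: fun_eq_iff g_of_def sigma_of_def star_of_def)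
  have f: "f_of (sigma_of dot tri) w z = dot (inv (dot z) w) (tri z (inv (dot z) w))" for w z
    by (simp add: f_of_def sigma_of_def star_of_def)
  have "inj (dot z)" "surj (dot z)" for z
    using assms bij_is_inj bij_is_surj by blast+
  then show "assoc_tri (sigma_of dot tri) x y = tri x y"
    by (simp add: assoc_tri_def g f inv_inv_eq assms)
qed

lemma sigma_of_assoc:
  fixes \<sigma> :: "'a \<times> 'a \<Rightarrow> 'a \<times> 'a"
  assumes "birack \<sigma>"
  shows "sigma_of (assoc_dot \<sigma>) (assoc_tri \<sigma>) = \<sigma>"
proof
  fix p :: "'a \<times> 'a"
  obtain x y where p: "p = (x, y)" by force
  have "bij (g_of \<sigma> z)" for z
    using assms by (simp add: birack_def)
  then show "sigma_of (assoc_dot \<sigma>) (assoc_tri \<sigma>) p = \<sigma> p"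
    by (simp add: p sigma_of_def star_of_def assoc_dot_def assoc_tri_def inv_inv_eq bij_is_inj)
       (simp add: g_of_def f_of_def)
qed

end

theory Submission imports Defs begin

text \<open>Both components of \<open>sigma_of dot tri\<close> are built from u = x * y, so it
  suffices to follow u. Replacing x by \<phi>(x) leaves u unchanged, as \<phi>(x) and x have the
  same left multiplication; only the factor \<open>tri x u\<close> feels the change
  (\<open>twist_left_sigma_of\<close>). On the right, twisting the dot replaces u by x *
  \<phi>^{-1}(y) (\<open>star_of_dot_twist\<close>), and the \<phi> it adds in the second component
  is absorbed by the \<phi>^{-1} in the twisted \<open>tri\<close>
  (\<open>twist_right_sigma_of\<close>).\<close>

text \<open>Linearity is defined through the operations associated to the map; for
  \<open>sigma_of dot tri\<close> these are \<open>dot\<close> and \<open>tri\<close> again.\<close>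

lemma linear_automorphism_sigma_ofD:
  assumes "\<And>x. bij (dot x)" and "linear_automorphism (sigma_of dot tri) \<phi>"
  shows "bij \<phi>"
    and "\<phi> (dot x y) = dot x (\<phi> y)"
    and "dot (\<phi> x) = dot x"
    and "\<phi> (tri x y) = tri (\<phi> x) y"
  using assms(2)
  by (simp_all add: linear_automorphism_def assoc_dot_sigma_of assoc_tri_sigma_of assms(1) fun_eq_iff)

lemma dot_twist_eq_comp:
  assumes "\<And>x y. \<phi> (dot x y) = dot x (\<phi> y)"
  shows "dot_twist dot \<phi> x = \<phi> \<circ> dot x"
  by (simp add: fun_eq_iff dot_twist_def assms)

text \<open>Inverting \<phi> \<circ> \<open>dot x\<close> reverses the order, so \<phi>^{-1} acts on
  the argument first, just as in precomposition with Id \<times> \<phi>^{-1}.\<close>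

lemma star_of_dot_twist:
  assumes "\<And>x. bij (dot x)" and "bij \<phi>" and "\<And>x y. \<phi> (dot x y) = dot x (\<phi> y)"
  shows "star_of (dot_twist dot \<phi>) x y = star_of dot x (inv \<phi> y)"
  using assms(1)[of x] assms(2)
  by (simp add: star_of_def dot_twist_eq_comp[of \<phi> dot, OF assms(3)] o_inv_distrib)

lemma twist_left_sigma_of:
  assumes "\<And>x. dot (\<phi> x) = dot x"
  shows "twist_left \<phi> (sigma_of dot tri) = sigma_of dot (tri_twist tri \<phi>)"
  by (simp add: fun_eq_iff twist_left_def sigma_of_def star_of_def tri_twist_def assms)

lemma twist_right_sigma_of:
  assumes "\<And>x. bij (dot x)" and "bij \<phi>"
    and "\<And>x y. \<phi> (dot x y) = dot x (\<phi> y)"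
    and "\<And>x y. \<phi> (tri x y) = tri (\<phi> x) y"
  shows "twist_right (sigma_of dot tri) (inv \<phi>)
    = sigma_of (dot_twist dot \<phi>) (tri_twist tri (inv \<phi>))"
proof -
  \<comment> \<open>With u = x * \<phi>^{-1}(y), the second component needs
    \<phi>(\<open>tri\<close> (\<phi>^{-1}(x)) u) = \<open>tri x u\<close>: move \<phi> into the
    first argument and cancel.\<close>
  have "\<phi> (inv \<phi> x) = x" for x
    using assms(2) by (simp add: bij_is_surj surj_f_inv_f)
  then show ?thesis
    by (simp add: fun_eq_iff twist_right_def sigma_of_def star_of_dot_twist[of dot \<phi>, OF assms(1-3)]
        tri_twist_def dot_twist_def assms(4))
qed

theorem proposition3p13:
  fixes dot tri :: "'a \<Rightarrow> 'a \<Rightarrow> 'a" and \<phi> :: "'a \<Rightarrow> 'a"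
  assumes "\<forall>x. bij (dot x)"
    and "birack (sigma_of dot tri)"
    and "linear_automorphism (sigma_of dot tri) \<phi>"
  shows "(\<forall>x y. dot_twist dot \<phi> x y = \<phi> (dot x y)) \<and>
    (\<forall>x. bij (dot_twist dot \<phi> x)) \<and>
    twist_left \<phi> (sigma_of dot tri) = sigma_of dot (tri_twist tri \<phi>) \<and>
    twist_right (sigma_of dot tri) (inv \<phi>)
      = sigma_of (dot_twist dot \<phi>) (tri_twist tri (inv \<phi>))"
proof (intro conjI allI)
  have dot: "bij (dot x)" for x
    using assms(1) by blast
  note \<phi> = linear_automorphism_sigma_ofD[OF dot assms(3)]
  show "dot_twist dot \<phi> x y = \<phi> (dot x y)" for x y
    by (simp add: dot_twist_def \<phi>(2))
  \<comment> \<open>This makes \<open>star_of\<close> of the twisted operation a true inverse, so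
    that the right-hand side of the second formula is meaningful.\<close>
  show "bij (dot_twist dot \<phi> x)" for x
    using dot_twist_eq_comp[of \<phi> dot, OF \<phi>(2)] bij_comp[OF dot \<phi>(1)] by simp
  show "twist_left \<phi> (sigma_of dot tri) = sigma_of dot (tri_twist tri \<phi>)"
    by (rule twist_left_sigma_of) (rule \<phi>(3))
  show "twist_right (sigma_of dot tri) (inv \<phi>)
      = sigma_of (dot_twist dot \<phi>) (tri_twist tri (inv \<phi>))"
    by (rule twist_right_sigma_of[of dot \<phi> tri, OF dot \<phi>(1,2,4)])
qed

end
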